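(* Let $\mathcal Q=(0,\infty)\times[0,T)$ and let $U(\omega,t)=V(\omega,1,t)$, where $V$ is the value function described in the context, be a classical solution of $$\begin{cases}\max\Big\{\partial_tU+\sup\limits_{\hat\pi\in\mathbb R}\big\{\tfrac12\sigma^2\hat\pi^2\partial_{\omega\omega}U+\mu\hat\pi\partial_\omega U\big\}+\sup\limits_{\alpha\le\hat c\le1}\big\{\tfrac{\hat c^{1-p}}{1-p}-\hat c\,\partial_\omega U\big\}-\delta U,\ (1-p)U-\omega\partial_\omega U\Big\}=0,&(\omega,t)\in\mathcal Q,\\ U(0,t)=0,& t\in[0,T),\\ U(\omega,T)=\frac{\omega^{1-p}}{1-p},&\omega\ge0.\end{cases}$$ Then $\partial_{\omega\omega}U(\omega,t)<0$ and $\partial_\omega U(\omega,t)>0$ for all $(\omega,t)\in\mathcal Q$.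
   Context: Parameters: $T>0$, $\mu>0$, $\sigma>0$, $\delta\ge0$, $0<p<1$, $0<\alpha<1$. The value function is $$V(x,z,t)=\sup_{(\pi,c)\in\mathcal A(x)}\mathbb E\Big[\int_t^{T\wedge\tau}e^{-\delta(s-t)}\tfrac{c_s^{1-p}}{1-p}ds+e^{-\delta(T\wedge\tau-t)}\tfrac{X_{T\wedge\tau}^{1-p}}{1-p}\,\Big|\,X_t=x,z_t=z\Big],$$ where $dX_t=(\mu\pi_t-c_t)dt+\sigma\pi_tdW_t$ ($W$ a Brownian motion), $z_t=\max\{z,\sup_{s\le t}c_s\}$, $\tau=\inf\{t\ge0:X_t\le0\}$, and $\mathcal A(x)$ is the set of pairs $(\pi,c)$ with $\pi$ progressively measurable, $c$ predictable, $\mathbb E[\int_0^T(c_t+\pi_t^2)dt]<\infty$ and $c_t\ge\alpha z_t$ a.s. for all $t\in[0,T]$. By homogeneity, $V(x,z,t)=z^{1-p}U(x/z,t)$. A classical solution is a $C^{2,1}(\mathcal Q)$ function ($C^2$ in $\omega$, $C^1$ in $t$) satisfying the problem pointwise. *)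

theory Defs
  imports "HOL-Probability.Probability"
begin

text \<open>The time index of the filtration and of the processes is \<^typ>\<open>real\<close>; only
  nonnegative times matter (a filtration on the nonnegative times extends to all times by its
  value at time 0).\<close>

locale brownian_motion = prob_space M + filtration "space M" F
  for M :: "'a measure" and F :: "real \<Rightarrow> 'a measure" +
  fixes W :: "real \<Rightarrow> 'a \<Rightarrow> real"
  assumes sets_F_subset: "\<And>t. sets (F t) \<subseteq> sets M"
    and W_adapted: "\<And>t. 0 \<le> t \<Longrightarrow> W t \<in> borel_measurable (F t)"
    and W_zero: "AE \<omega> in M. W 0 \<omega> = 0"
    and W_continuous: "AE \<omega> in M. continuous_on {0..} (\<lambda>t. W t \<omega>)"
    and W_gaussian: "\<And>s t. 0 \<le> s \<Longrightarrow> s < t \<Longrightarrow>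
      distributed M lborel (\<lambda>\<omega>. W t \<omega> - W s \<omega>) (normal_density 0 (sqrt (t - s)))"
    and W_indep: "\<And>s t. 0 \<le> s \<Longrightarrow> s < t \<Longrightarrow>
      indep_set (sets (F s)) {(\<lambda>\<omega>. W t \<omega> - W s \<omega>) -` A \<inter> space M | A. A \<in> sets borel}"

section \<open>Measurability of processes on a time interval\<close>

definition progressively_measurable ::
    "(real \<Rightarrow> 'a measure) \<Rightarrow> real \<Rightarrow> real \<Rightarrow> (real \<Rightarrow> 'a \<Rightarrow> real) \<Rightarrow> bool" where
  "progressively_measurable F t0 T H \<longleftrightarrow>
     (\<forall>s\<in>{t0..T}. (\<lambda>(u, \<omega>). H u \<omega>) \<in>
        borel_measurable (restrict_space borel {t0..s} \<Otimes>\<^sub>M F s))"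

definition predictable_sigma ::
    "'a measure \<Rightarrow> (real \<Rightarrow> 'a measure) \<Rightarrow> real \<Rightarrow> real \<Rightarrow> (real \<times> 'a) measure" where
  "predictable_sigma M F t0 T = sigma ({t0..T} \<times> space M)
     ({{t0} \<times> A | A. A \<in> sets (F t0)} \<union>
      {{a<..b} \<times> A | a b A. t0 \<le> a \<and> a \<le> b \<and> b \<le> T \<and> A \<in> sets (F a)})"

definition predictable ::
    "'a measure \<Rightarrow> (real \<Rightarrow> 'a measure) \<Rightarrow> real \<Rightarrow> real \<Rightarrow> (real \<Rightarrow> 'a \<Rightarrow> real) \<Rightarrow> bool" where
  "predictable M F t0 T H \<longleftrightarrow>
     (\<lambda>(u, \<omega>). H u \<omega>) \<in> borel_measurable (predictable_sigma M F t0 T)"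

section \<open>The Ito integral\<close>

text \<open>A simple integrand is \<open>\<Sum>i<n. h i * 1_(r i, r (Suc i)]\<close> with bounded
  \<open>F (r i)\<close>-measurable \<open>h i\<close>.\<close>

definition simple_integrand ::
    "'a measure \<Rightarrow> (real \<Rightarrow> 'a measure) \<Rightarrow> real \<Rightarrow> real \<Rightarrow>
     nat \<Rightarrow> (nat \<Rightarrow> real) \<Rightarrow> (nat \<Rightarrow> 'a \<Rightarrow> real) \<Rightarrow> bool" where
  "simple_integrand M F t0 T n r h \<longleftrightarrow>
     t0 \<le> r 0 \<and> (\<forall>i<n. r i \<le> r (Suc i)) \<and> r n \<le> T \<and>
     (\<forall>i<n. h i \<in> borel_measurable (F (r i)) \<and> (\<exists>B. \<forall>\<omega>\<in>space M. \<bar>h i \<omega>\<bar> \<le> B))"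

definition simple_process ::
    "nat \<Rightarrow> (nat \<Rightarrow> real) \<Rightarrow> (nat \<Rightarrow> 'a \<Rightarrow> real) \<Rightarrow> real \<Rightarrow> 'a \<Rightarrow> real" where
  "simple_process n r h u \<omega> = (\<Sum>i<n. h i \<omega> * indicator {r i<..r (Suc i)} u)"

definition simple_integral ::
    "(real \<Rightarrow> 'a \<Rightarrow> real) \<Rightarrow> nat \<Rightarrow> (nat \<Rightarrow> real) \<Rightarrow> (nat \<Rightarrow> 'a \<Rightarrow> real) \<Rightarrow> real \<Rightarrow> 'a \<Rightarrow> real" where
  "simple_integral W n r h s \<omega> =
     (\<Sum>i<n. h i \<omega> * (W (min (r (Suc i)) s) \<omega> - W (min (r i) s) \<omega>))"

text \<open>\<open>I\<close> is a continuous version of the integral process of \<open>H\<close> against \<open>W\<close> started at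
  \<open>t0\<close>: the mean-square limit of the integrals of simple integrands that approximate \<open>H\<close>
  in mean square. It is unique up to indistinguishability, hence a relation.\<close>

definition is_ito_integral ::
    "'a measure \<Rightarrow> (real \<Rightarrow> 'a measure) \<Rightarrow> (real \<Rightarrow> 'a \<Rightarrow> real) \<Rightarrow> real \<Rightarrow> real \<Rightarrow>
     (real \<Rightarrow> 'a \<Rightarrow> real) \<Rightarrow> (real \<Rightarrow> 'a \<Rightarrow> real) \<Rightarrow> bool" where
  "is_ito_integral M F W t0 T H I \<longleftrightarrow>
     (AE \<omega> in M. continuous_on {t0..T} (\<lambda>s. I s \<omega>)) \<and>
     (\<forall>s\<in>{t0..T}. I s \<in> borel_measurable M) \<and>
     (\<exists>n r h. (\<forall>k::nat. simple_integrand M F t0 T (n k) (r k) (h k)) \<and>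
        (\<lambda>k. \<integral>\<^sup>+\<omega>. (\<integral>\<^sup>+u\<in>{t0..T}.
            ennreal ((simple_process (n k) (r k) (h k) u \<omega> - H u \<omega>)\<^sup>2) \<partial>lborel) \<partial>M)
          \<longlonglongrightarrow> 0 \<and>
        (\<forall>s\<in>{t0..T}.
          (\<lambda>k. \<integral>\<^sup>+\<omega>. ennreal ((simple_integral W (n k) (r k) (h k) s \<omega> - I s \<omega>)\<^sup>2) \<partial>M)
            \<longlonglongrightarrow> 0))"

section \<open>The control problem\<close>

text \<open>The problem is started at time \<open>t\<close> from wealth \<open>x\<close> and consumption peak \<open>z\<close>; controls
  and wealth live on the interval from \<open>t\<close> to \<open>T\<close>. The peak may be infinite along a path, so it
  is extended-real valued.\<close>

definition peak :: "real \<Rightarrow> real \<Rightarrow> (real \<Rightarrow> 'a \<Rightarrow> real) \<Rightarrow> real \<Rightarrow> 'a \<Rightarrow> ereal" where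
  "peak t z c s \<omega> = max (ereal z) (SUP u\<in>{t..s}. ereal (c u \<omega>))"

definition admissible ::
    "'a measure \<Rightarrow> (real \<Rightarrow> 'a measure) \<Rightarrow> real \<Rightarrow> real \<Rightarrow> real \<Rightarrow> real \<Rightarrow>
     (real \<Rightarrow> 'a \<Rightarrow> real) \<Rightarrow> (real \<Rightarrow> 'a \<Rightarrow> real) \<Rightarrow> bool" where
  "admissible M F T \<alpha> z t \<pi> c \<longleftrightarrow>
     progressively_measurable F t T \<pi> \<and> predictable M F t T c \<and>
     (\<integral>\<^sup>+\<omega>. (\<integral>\<^sup>+s\<in>{t..T}. ennreal (c s \<omega> + (\<pi> s \<omega>)\<^sup>2) \<partial>lborel) \<partial>M) < \<infinity> \<and>
     (\<forall>s\<in>{t..T}. AE \<omega> in M. ereal \<alpha> * peak t z c s \<omega> \<le> ereal (c s \<omega>))"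

text \<open>\<open>dX = (\<mu> \<pi> - c) ds + \<sigma> \<pi> dW\<close>, started from \<open>x\<close> at time \<open>t\<close>.\<close>

definition is_wealth ::
    "'a measure \<Rightarrow> (real \<Rightarrow> 'a measure) \<Rightarrow> (real \<Rightarrow> 'a \<Rightarrow> real) \<Rightarrow> real \<Rightarrow> real \<Rightarrow> real \<Rightarrow>
     real \<Rightarrow> real \<Rightarrow> (real \<Rightarrow> 'a \<Rightarrow> real) \<Rightarrow> (real \<Rightarrow> 'a \<Rightarrow> real) \<Rightarrow> (real \<Rightarrow> 'a \<Rightarrow> real) \<Rightarrow> bool" where
  "is_wealth M F W T \<mu> \<sigma> x t \<pi> c X \<longleftrightarrow>
     (AE \<omega> in M. continuous_on {t..T} (\<lambda>s. X s \<omega>)) \<and>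
     (\<forall>s\<in>{t..T}. X s \<in> borel_measurable M) \<and>
     (\<exists>I. is_ito_integral M F W t T \<pi> I \<and>
        (\<forall>s\<in>{t..T}. AE \<omega> in M.
           X s \<omega> = x + (LBINT u:{t..s}. \<mu> * \<pi> u \<omega> - c u \<omega>) + \<sigma> * I s \<omega>))"

text \<open>\<open>min T \<tau>\<close> for the bankruptcy time \<open>\<tau>\<close>: inserting \<open>T\<close> both caps the infimum and
  covers the paths that never hit zero.\<close>

definition stop_time :: "real \<Rightarrow> real \<Rightarrow> (real \<Rightarrow> 'a \<Rightarrow> real) \<Rightarrow> 'a \<Rightarrow> real" where
  "stop_time T t X \<omega> = Inf (insert T {s\<in>{t..T}. X s \<omega> \<le> 0})"

definition payoff ::
    "'a measure \<Rightarrow> real \<Rightarrow> real \<Rightarrow> real \<Rightarrow> real \<Rightarrow>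
     (real \<Rightarrow> 'a \<Rightarrow> real) \<Rightarrow> (real \<Rightarrow> 'a \<Rightarrow> real) \<Rightarrow> ereal" where
  "payoff M T \<delta> p t c X = enn2ereal (\<integral>\<^sup>+\<omega>.
     (\<integral>\<^sup>+s\<in>{t..stop_time T t X \<omega>}.
        ennreal (exp (- \<delta> * (s - t)) * (c s \<omega> powr (1 - p) / (1 - p))) \<partial>lborel) +
     ennreal (exp (- \<delta> * (stop_time T t X \<omega> - t)) *
        (X (stop_time T t X \<omega>) \<omega> powr (1 - p) / (1 - p))) \<partial>M)"

definition value_function ::
    "'a measure \<Rightarrow> (real \<Rightarrow> 'a measure) \<Rightarrow> (real \<Rightarrow> 'a \<Rightarrow> real) \<Rightarrow>
     real \<Rightarrow> real \<Rightarrow> real \<Rightarrow> real \<Rightarrow> real \<Rightarrow> real \<Rightarrow> real \<Rightarrow> real \<Rightarrow> real \<Rightarrow> ereal" where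
  "value_function M F W T \<mu> \<sigma> \<delta> p \<alpha> x z t =
     Sup {payoff M T \<delta> p t c X | \<pi> c X.
       admissible M F T \<alpha> z t \<pi> c \<and> is_wealth M F W T \<mu> \<sigma> x t \<pi> c X}"

section \<open>Classical solutions of the boundary value problem\<close>

text \<open>From here on \<open>\<omega>\<close> is the wealth-to-peak ratio.\<close>

definition Q :: "real \<Rightarrow> (real \<times> real) set" where
  "Q T = {0<..} \<times> {0..<T}"

definition D\<omega> :: "(real \<Rightarrow> real \<Rightarrow> real) \<Rightarrow> real \<Rightarrow> real \<Rightarrow> real" where
  "D\<omega> U \<omega> t = deriv (\<lambda>y. U y t) \<omega>"

definition D\<omega>\<omega> :: "(real \<Rightarrow> real \<Rightarrow> real) \<Rightarrow> real \<Rightarrow> real \<Rightarrow> real" where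
  "D\<omega>\<omega> U \<omega> t = deriv (deriv (\<lambda>y. U y t)) \<omega>"

text \<open>The time derivative is one-sided at time 0.\<close>

definition Dt :: "real \<Rightarrow> (real \<Rightarrow> real \<Rightarrow> real) \<Rightarrow> real \<Rightarrow> real \<Rightarrow> real" where
  "Dt T U \<omega> t = vector_derivative (\<lambda>s. U \<omega> s) (at t within {0..<T})"

definition C21 :: "real \<Rightarrow> (real \<Rightarrow> real \<Rightarrow> real) \<Rightarrow> bool" where
  "C21 T U \<longleftrightarrow>
     (\<forall>(\<omega>, t)\<in>Q T. (\<lambda>y. U y t) differentiable at \<omega> \<and>
        deriv (\<lambda>y. U y t) differentiable at \<omega> \<and>
        (\<lambda>s. U \<omega> s) differentiable at t within {0..<T}) \<and>
     continuous_on (Q T) (\<lambda>(\<omega>, t). U \<omega> t) \<and>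
     continuous_on (Q T) (\<lambda>(\<omega>, t). D\<omega> U \<omega> t) \<and>
     continuous_on (Q T) (\<lambda>(\<omega>, t). D\<omega>\<omega> U \<omega> t) \<and>
     continuous_on (Q T) (\<lambda>(\<omega>, t). Dt T U \<omega> t)"

text \<open>The suprema are taken in the extended reals: the first one may be infinite.\<close>

definition hjb_operator ::
    "real \<Rightarrow> real \<Rightarrow> real \<Rightarrow> real \<Rightarrow> real \<Rightarrow> real \<Rightarrow> (real \<Rightarrow> real \<Rightarrow> real) \<Rightarrow> real \<Rightarrow> real \<Rightarrow> ereal" where
  "hjb_operator T \<mu> \<sigma> \<delta> p \<alpha> U \<omega> t =
     ereal (Dt T U \<omega> t)
     + (SUP \<pi>\<in>UNIV. ereal (1/2 * \<sigma>\<^sup>2 * \<pi>\<^sup>2 * D\<omega>\<omega> U \<omega> t + \<mu> * \<pi> * D\<omega> U \<omega> t))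
     + (SUP c\<in>{\<alpha>..1}. ereal (c powr (1 - p) / (1 - p) - c * D\<omega> U \<omega> t))
     - ereal (\<delta> * U \<omega> t)"

definition classical_solution ::
    "real \<Rightarrow> real \<Rightarrow> real \<Rightarrow> real \<Rightarrow> real \<Rightarrow> real \<Rightarrow> (real \<Rightarrow> real \<Rightarrow> real) \<Rightarrow> bool" where
  "classical_solution T \<mu> \<sigma> \<delta> p \<alpha> U \<longleftrightarrow>
     C21 T U \<and>
     (\<forall>(\<omega>, t)\<in>Q T. max (hjb_operator T \<mu> \<sigma> \<delta> p \<alpha> U \<omega> t)
        (ereal ((1 - p) * U \<omega> t - \<omega> * D\<omega> U \<omega> t)) = 0) \<and>
     (\<forall>t\<in>{0..<T}. U 0 t = 0) \<and>
     (\<forall>\<omega>\<ge>0. U \<omega> T = \<omega> powr (1 - p) / (1 - p))"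

end

theory Submission
  imports Defs
begin

text \<open>Finiteness of the supremum over \<open>\<pi>\<close> in the equation forces \<open>D\<omega>\<omega> U < 0\<close> as soon as
  \<open>D\<omega> U > 0\<close>, and the gradient constraint \<open>(1 - p) U \<le> \<omega> D\<omega> U\<close> gives \<open>D\<omega> U > 0\<close> as soon as
  \<open>U > 0\<close>. The value function is positive because not investing and consuming at the minimal
  rate \<open>\<alpha>\<close> keeps the wealth positive for a positive time.\<close>

text \<open>The simple integrand with no summands, taken at every index, makes both mean-square
  errors identically zero.\<close>

lemma is_ito_integral_zero:
  assumes "t \<le> T"
  shows "is_ito_integral M F W t T (\<lambda>_ _. 0) (\<lambda>_ _. 0)"
proof -
  have "simple_integrand M F t T 0 (\<lambda>_. t) (\<lambda>_ _. 0)"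
    using assms by (simp add: simple_integrand_def)
  then show ?thesis
    unfolding is_ito_integral_def
    by (intro conjI exI[of _ "\<lambda>_. 0"] exI[of _ "\<lambda>_ _. t"] exI[of _ "\<lambda>_ _ _. 0"])
      (auto simp: simple_process_def simple_integral_def)
qed

text \<open>Without investment the wealth equation is deterministic. The formula may turn negative
  before \<open>T\<close>; this is harmless, since \<open>payoff\<close> stops at
  bankruptcy.\<close>

lemma is_wealth_constant_consumption:
  assumes "t \<le> T"
  shows "is_wealth M F W T \<mu> \<sigma> x t (\<lambda>_ _. 0) (\<lambda>_ _. c) (\<lambda>s _. x - c * (s - t))"
  unfolding is_wealth_def
  by (intro conjI exI[of _ "\<lambda>_ _. 0"] is_ito_integral_zero[OF assms])
    (auto intro!: continuous_intros simp: set_lebesgue_integral_def)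

text \<open>As \<alpha> \<le> 1, consuming at rate \<alpha> never lifts the peak above its initial
  value 1, so the drawdown constraint holds with equality.\<close>

lemma admissible_minimal_consumption:
  assumes "prob_space M" "t \<le> T" "0 \<le> \<alpha>" "\<alpha> \<le> 1"
  shows "admissible M F T \<alpha> 1 t (\<lambda>_ _. 0) (\<lambda>_ _. \<alpha>)"
proof -
  interpret prob_space M by fact
  have "peak t 1 (\<lambda>_ _. \<alpha>) s \<omega> = 1" if "s \<in> {t..T}" for s and \<omega> :: 'a
    using that assms by (auto simp: peak_def max_def)
  moreover have "(\<integral>\<^sup>+\<omega>. (\<integral>\<^sup>+s\<in>{t..T}. ennreal (\<alpha> + 0\<^sup>2) \<partial>lborel) \<partial>M) < \<infinity>"
    using assms by (simp add: nn_integral_cmult_indicator emeasure_space_1 ennreal_mult_less_top)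
  ultimately show ?thesis
    by (auto simp: admissible_def progressively_measurable_def predictable_def)
qed

text \<open>The wealth is deterministic, so the stopping time is a constant \<open>S\<close>. The
  running utility on \<open>{t..S}\<close> alone is positive, and the terminal utility can only add
  to it.\<close>

lemma payoff_minimal_consumption_pos:
  assumes "prob_space M" "t < T" "0 < x" "0 < c" "0 \<le> \<delta>" "p < 1"
  shows "0 < payoff M T \<delta> p t (\<lambda>_ _. c) (\<lambda>s _. x - c * (s - t))"
proof -
  interpret prob_space M by fact
  let ?X = "\<lambda>s (_::'a). x - c * (s - t)"
  define S where "S = Inf (insert T {s \<in> {t..T}. x - c * (s - t) \<le> 0})"
  have S: "stop_time T t ?X \<omega> = S" for \<omega>
    by (simp add: stop_time_def S_def)
  \<comment> \<open>The line \<open>x - c * (s - t)\<close> reaches zero at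
    \<open>s = t + x / c\<close>, which lies after \<open>t\<close>.\<close>
  have "min T (t + x / c) \<le> S"
    unfolding S_def using assms
    by (intro cInf_greatest) (auto simp: field_simps min_le_iff_disj)
  then have "t < S"
    using assms by (smt (verit) divide_pos_pos)
  have "S \<le> T"
    unfolding S_def by (rule cInf_lower) (auto intro!: bdd_belowI[of _ "min t T"])
  \<comment> \<open>Discounting up to \<open>T\<close> is the heaviest since \<delta> \<ge> 0, so
    \<open>K\<close> bounds the running utility from below on \<open>{t..S}\<close>.\<close>
  define K where "K = exp (- \<delta> * (T - t)) * (c powr (1 - p) / (1 - p))"
  have "0 < K"
    using assms by (simp add: K_def)
  have "0 < ennreal K * emeasure lborel {t..S}"
    using \<open>0 < K\<close> \<open>t < S\<close> by (simp add: ennreal_zero_less_mult_iff)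
  also have "\<dots> = (\<integral>\<^sup>+s\<in>{t..S}. ennreal K \<partial>lborel)"
    by (simp add: nn_integral_cmult_indicator)
  also have "\<dots> \<le> (\<integral>\<^sup>+s\<in>{t..S}. ennreal (exp (- \<delta> * (s - t)) * (c powr (1 - p) / (1 - p))) \<partial>lborel)"
    using assms \<open>S \<le> T\<close>
    by (intro nn_integral_mono)
      (auto simp: K_def indicator_def intro!: ennreal_leI mult_right_mono mult_left_mono divide_right_mono)
  also have "\<dots> \<le> \<dots> + ennreal (exp (- \<delta> * (S - t)) * ((x - c * (S - t)) powr (1 - p) / (1 - p)))"
    by simp
  finally show ?thesis
    by (simp add: payoff_def S emeasure_space_1 less_ennreal.rep_eq zero_ennreal.rep_eq)
qed

lemma value_function_pos:
  assumes "prob_space M" "t < T" "0 < x" "0 < \<alpha>" "\<alpha> \<le> 1" "0 \<le> \<delta>" "p < 1"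
  shows "0 < value_function M F W T \<mu> \<sigma> \<delta> p \<alpha> x 1 t"
proof -
  have "0 < payoff M T \<delta> p t (\<lambda>_ _. \<alpha>) (\<lambda>s _. x - \<alpha> * (s - t))"
    using assms by (intro payoff_minimal_consumption_pos) auto
  also have "\<dots> \<le> value_function M F W T \<mu> \<sigma> \<delta> p \<alpha> x 1 t"
    unfolding value_function_def
    using admissible_minimal_consumption[of M t T \<alpha> F]
      is_wealth_constant_consumption[of t T M F W \<mu> \<sigma> x \<alpha>] assms
    by (intro Sup_upper) (force intro: less_imp_le)
  finally show ?thesis .
qed

lemma SUP_quadratic_eq_top:
  fixes a b \<mu> :: real
  assumes "0 \<le> a" "0 < \<mu> * b"
  shows "(SUP \<pi>\<in>UNIV. ereal (1/2 * \<sigma>\<^sup>2 * \<pi>\<^sup>2 * a + \<mu> * \<pi> * b)) = \<infinity>"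
proof (rule SUP_PInfty)
  fix n :: nat
  \<comment> \<open>This \<pi> makes the linear term equal to \<open>n\<close>; the quadratic term
    is nonnegative because \<open>0 \<le> a\<close>.\<close>
  have "real n = \<mu> * (real n / (\<mu> * b)) * b"
    using assms by (auto simp: field_simps)
  also have "\<dots> \<le> 1/2 * \<sigma>\<^sup>2 * (real n / (\<mu> * b))\<^sup>2 * a + \<mu> * (real n / (\<mu> * b)) * b"
    using assms by simp
  finally show "\<exists>\<pi>\<in>UNIV. ereal (real n) \<le> ereal (1/2 * \<sigma>\<^sup>2 * \<pi>\<^sup>2 * a + \<mu> * \<pi> * b)"
    by (intro bexI[of _ "real n / (\<mu> * b)"]) simp_all
qed

lemma D\<omega>\<omega>_neg_if_hjb_operator_le_0:
  assumes "hjb_operator T \<mu> \<sigma> \<delta> p \<alpha> U \<omega> t \<le> 0" "0 < \<mu>" "0 < D\<omega> U \<omega> t"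
  shows "D\<omega>\<omega> U \<omega> t < 0"
proof (rule ccontr)
  assume "\<not> D\<omega>\<omega> U \<omega> t < 0"
  \<comment> \<open>In \<open>ereal\<close> the value \<infinity> absorbs every summand, even
    -\<infinity>, so the supremum over consumption needs no bound.\<close>
  with assms(2,3) have "hjb_operator T \<mu> \<sigma> \<delta> p \<alpha> U \<omega> t = \<infinity>"
    unfolding hjb_operator_def by (subst SUP_quadratic_eq_top) simp_all
  with assms(1) show False by simp
qed

theorem lemma2p3:
  fixes M :: "'a measure" and F :: "real \<Rightarrow> 'a measure" and W :: "real \<Rightarrow> 'a \<Rightarrow> real"
    and T \<mu> \<sigma> \<delta> p \<alpha> :: real and U :: "real \<Rightarrow> real \<Rightarrow> real"
  assumes "brownian_motion M F W"
    and "T > 0" and "\<mu> > 0" and "\<sigma> > 0" and "\<delta> \<ge> 0"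
    and "0 < p" and "p < 1" and "0 < \<alpha>" and "\<alpha> < 1"
    and "\<And>\<omega> t. \<omega> \<ge> 0 \<Longrightarrow> t \<in> {0..T} \<Longrightarrow>
      ereal (U \<omega> t) = value_function M F W T \<mu> \<sigma> \<delta> p \<alpha> \<omega> 1 t"
    and "classical_solution T \<mu> \<sigma> \<delta> p \<alpha> U"
  shows "\<forall>(\<omega>, t)\<in>Q T. D\<omega>\<omega> U \<omega> t < 0 \<and> D\<omega> U \<omega> t > 0"
proof (intro ballI, clarify)
  fix \<omega> t
  assume "(\<omega>, t) \<in> Q T"
  then have \<omega>: "0 < \<omega>" and t: "0 \<le> t" "t < T"
    by (auto simp: Q_def)
  have "prob_space M"
    using assms(1) by (simp add: brownian_motion_def)
  then have "0 < value_function M F W T \<mu> \<sigma> \<delta> p \<alpha> \<omega> 1 t"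
    using assms \<omega> t by (intro value_function_pos) auto
  \<comment> \<open>The identification of \<open>U\<close> with the value function enters here; what
    follows uses only the equation.\<close>
  then have "0 < U \<omega> t"
    using assms(10)[of \<omega> t] \<omega> t by (simp flip: ereal_less(2))
  have "max (hjb_operator T \<mu> \<sigma> \<delta> p \<alpha> U \<omega> t) (ereal ((1 - p) * U \<omega> t - \<omega> * D\<omega> U \<omega> t)) = 0"
    using assms(11) \<open>(\<omega>, t) \<in> Q T\<close> by (auto simp: classical_solution_def)
  then have hjb: "hjb_operator T \<mu> \<sigma> \<delta> p \<alpha> U \<omega> t \<le> 0"
    and "ereal ((1 - p) * U \<omega> t - \<omega> * D\<omega> U \<omega> t) \<le> 0"
    by (metis max.cobounded1, metis max.cobounded2)
  then have "(1 - p) * U \<omega> t \<le> \<omega> * D\<omega> U \<omega> t"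
    by simp
  moreover have "0 < (1 - p) * U \<omega> t"
    using \<open>0 < U \<omega> t\<close> \<open>p < 1\<close> by simp
  ultimately have "0 < D\<omega> U \<omega> t"
    using \<omega> by (metis order_less_le_trans zero_less_mult_pos)
  with D\<omega>\<omega>_neg_if_hjb_operator_le_0[OF hjb \<open>0 < \<mu>\<close>]
  show "D\<omega>\<omega> U \<omega> t < 0 \<and> D\<omega> U \<omega> t > 0"
    by simp
qed

end
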